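(* Let $m\ge2$. For each ordered pair $(i,j)\in\{0,\dots,m-1\}^2$ and $n\ge2$ let $N_n^{i,j}$ be the number of pairs (full bracketing of $p_1\Rightarrow_G\cdots\Rightarrow_G p_n$, valuation $\nu:\{p_1,\dots,p_n\}\to V_m$) such that, writing the bracketing at its root as $\varphi\Rightarrow_G\psi$, one has $\nu(\varphi)=v_i$ and $\nu(\psi)=v_j$; set $N_1^{i,j}:=0$. Then: (i) There are exactly $m^2$ refined pair-sequences $\{N_n^{i,j}\}_{n\ge1}$, one for each ordered pair $(i,j)$. (ii) For all $(i,j)$, $N^{i,j}(x):=\sum_{n\ge1}N_n^{i,j}x^n=G_i(x)\,G_j(x)$, and in particular $N_1^{i,j}=0$. (iii) $v_i\Rightarrow_G v_j=v_{m-1}=1$ if $i\le j$ and $v_i\Rightarrow_G v_j=v_j$ if $i>j$. Hence $\frac{m(m+1)}2$ of the pair-sequences (those with $i\le j$) contribute to the top output value $v_{m-1}$, while for each $j\le m-2$ exactly $m-1-j$ pair-sequences (those with right index $j$ and $i>j$) contribute to the output value $v_j$.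
   Context: For an integer $m\ge2$ let $V_m=\{v_0<v_1<\cdots<v_{m-1}\}$ ($v_0=0$, $v_{m-1}=1$) be an $m$-element chain with Gödel implication $v_p\Rightarrow_G v_q=v_{m-1}$ if $p\le q$ and $v_p\Rightarrow_G v_q=v_q$ if $p>q$. For $n\ge1$, the full bracketings of $p_1\Rightarrow_G\cdots\Rightarrow_G p_n$ in $n$ distinct variables correspond to full binary trees with $n$ ordered leaves. For $n\ge2$ each bracketing is uniquely of the form $\varphi\Rightarrow_G\psi$ (root split), and $\nu(\varphi)$ denotes the value of subformula $\varphi$ under $\nu$. Let $g_n^{(k)}$ be the number of pairs (bracketing, valuation $\{p_1,\dots,p_n\}\to V_m$) for which the formula evaluates to $v_k$, and $G_k(x)=\sum_{n\ge1}g_n^{(k)}x^n$. Pair-sequences are counted as a family indexed by ordered pairs $(i,j)$ (not up to equality of sequences). A pair-sequence $(i,j)$ "contributes to output value $v_k$" if $v_i\Rightarrow_G v_j=v_k$. *)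

theory Defs
  imports
    "HOL-Library.FuncSet"
    "HOL-Computational_Algebra.Formal_Power_Series"
begin

text \<open>
  The chain is given by its enumeration \<open>v 0 < \<dots> < v (m - 1)\<close>, a strictly increasing map on
  \<open>{..<m}\<close>; values of \<open>v\<close> outside \<open>{..<m}\<close> are irrelevant.
\<close>

definition chain :: "nat \<Rightarrow> (nat \<Rightarrow> 'a) \<Rightarrow> 'a set" where
  "chain m v = v ` {..<m}"

definition chain_index :: "nat \<Rightarrow> (nat \<Rightarrow> 'a) \<Rightarrow> 'a \<Rightarrow> nat" where
  "chain_index m v = inv_into {..<m} v"

definition goedel_imp :: "nat \<Rightarrow> (nat \<Rightarrow> 'a) \<Rightarrow> 'a \<Rightarrow> 'a \<Rightarrow> 'a" where
  "goedel_imp m v a b =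
     (let p = chain_index m v a; q = chain_index m v b
      in if p \<le> q then v (m - 1) else v q)"

datatype formula = Var nat | Imp formula formula

fun leaves :: "formula \<Rightarrow> nat list" where
  "leaves (Var k) = [k]"
| "leaves (Imp \<phi> \<psi>) = leaves \<phi> @ leaves \<psi>"

text \<open>
  Full bracketings of \<open>p\<^sub>1 \<Rightarrow> \<dots> \<Rightarrow> p\<^sub>n\<close>: the leaves, read from left to right, are the
  variables \<open>1, \<dots>, n\<close>.
\<close>

definition bracketings :: "nat \<Rightarrow> formula set" where
  "bracketings n = {\<phi>. leaves \<phi> = [1..<Suc n]}"

definition valuations :: "nat \<Rightarrow> (nat \<Rightarrow> 'a) \<Rightarrow> nat \<Rightarrow> (nat \<Rightarrow> 'a) set" where
  "valuations m v n = {1..n} \<rightarrow>\<^sub>E chain m v"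

fun val :: "nat \<Rightarrow> (nat \<Rightarrow> 'a) \<Rightarrow> (nat \<Rightarrow> 'a) \<Rightarrow> formula \<Rightarrow> 'a" where
  "val m v \<nu> (Var k) = \<nu> k"
| "val m v \<nu> (Imp \<phi> \<psi>) = goedel_imp m v (val m v \<nu> \<phi>) (val m v \<nu> \<psi>)"

definition g :: "nat \<Rightarrow> (nat \<Rightarrow> 'a) \<Rightarrow> nat \<Rightarrow> nat \<Rightarrow> nat" where
  "g m v k n =
     card {(\<phi>, \<nu>). \<phi> \<in> bracketings n \<and> \<nu> \<in> valuations m v n \<and> val m v \<nu> \<phi> = v k}"

definition G :: "nat \<Rightarrow> (nat \<Rightarrow> 'a) \<Rightarrow> nat \<Rightarrow> nat fps" where
  "G m v k = Abs_fps (\<lambda>n. if n \<ge> 1 then g m v k n else 0)"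

definition N :: "nat \<Rightarrow> (nat \<Rightarrow> 'a) \<Rightarrow> nat \<Rightarrow> nat \<Rightarrow> nat \<Rightarrow> nat" where
  "N m v i j n =
     (if n \<ge> 2
      then card {(\<chi>, \<nu>). \<chi> \<in> bracketings n \<and> \<nu> \<in> valuations m v n \<and>
                   (\<exists>\<phi> \<psi>. \<chi> = Imp \<phi> \<psi> \<and> val m v \<nu> \<phi> = v i \<and> val m v \<nu> \<psi> = v j)}
      else 0)"

definition N_series :: "nat \<Rightarrow> (nat \<Rightarrow> 'a) \<Rightarrow> nat \<Rightarrow> nat \<Rightarrow> nat fps" where
  "N_series m v i j = Abs_fps (\<lambda>n. if n \<ge> 1 then N m v i j n else 0)"

text \<open>
  The pair-sequences form an indexed family, represented by its graph: each sequence is tagged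
  with its index pair, so that equal sequences with different indices count separately.
\<close>

definition pair_sequences ::
  "nat \<Rightarrow> (nat \<Rightarrow> 'a) \<Rightarrow> ((nat \<times> nat) \<times> (nat \<Rightarrow> nat)) set" where
  "pair_sequences m v = (\<lambda>(i, j). ((i, j), N m v i j)) ` ({..<m} \<times> {..<m})"

definition contributing ::
  "nat \<Rightarrow> (nat \<Rightarrow> 'a) \<Rightarrow> nat \<Rightarrow> ((nat \<times> nat) \<times> (nat \<Rightarrow> nat)) set" where
  "contributing m v k =
     {((i, j), s) \<in> pair_sequences m v. goedel_imp m v (v i) (v j) = v k}"

end

theory Submission
  imports Defs
begin

text \<open>
  Cutting a formula with \<open>n\<close> leaves at its root, together with the valuation, and renumbering the
  variables of the right factor is a bijection onto pairs of valued bracketings of sizes \<open>k\<close> and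
  \<open>n - k\<close>; this gives the Cauchy product. For (iii), the value \<open>v (m - 1)\<close> cannot arise from \<open>i > j\<close>,
  because then \<open>j < m - 1\<close> and \<open>v\<close> is injective.
\<close>

section \<open>Renaming of variables, and finiteness of the sets of bracketings and
  valuations\<close>

fun rename :: "(nat \<Rightarrow> nat) \<Rightarrow> formula \<Rightarrow> formula" where
  "rename f (Var k) = Var (f k)"
| "rename f (Imp \<phi> \<psi>) = Imp (rename f \<phi>) (rename f \<psi>)"

lemma leaves_rename [simp]: "leaves (rename f \<phi>) = map f (leaves \<phi>)"
  by (induction \<phi>) auto

lemma rename_id_on: "(\<And>x. x \<in> set (leaves \<phi>) \<Longrightarrow> f x = x) \<Longrightarrow> rename f \<phi> = \<phi>"
  by (induction \<phi>) auto

lemma rename_rename: "rename f (rename h \<phi>) = rename (f \<circ> h) \<phi>"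
  by (induction \<phi>) auto

lemma val_rename: "val m v \<nu> (rename f \<phi>) = val m v (\<nu> \<circ> f) \<phi>"
  by (induction \<phi>) auto

lemma val_cong:
  "(\<And>x. x \<in> set (leaves \<phi>) \<Longrightarrow> \<nu> x = \<mu> x) \<Longrightarrow> val m v \<nu> \<phi> = val m v \<mu> \<phi>"
  by (induction \<phi>) auto

lemma leaves_not_Nil [simp]: "leaves \<phi> \<noteq> []"
  by (induction \<phi>) auto

text \<open>The root of a compound formula cuts its leaf list into two nonempty, hence strictly
  shorter, pieces. There are finitely many places to cut, and the induction hypothesis bounds both
  factors. Finiteness matters later because cardinalities are added over a disjoint union.\<close>

lemma finite_leaves_eq: "finite {\<phi>. leaves \<phi> = xs}"
proof (induction xs rule: length_induct)
  case (1 xs)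
  let ?F = "\<lambda>xs. {\<phi>. leaves \<phi> = xs}"
  have "?F xs \<subseteq> Var ` set xs \<union>
      (\<Union>k\<in>{1..<length xs}. case_prod Imp ` (?F (take k xs) \<times> ?F (drop k xs)))" (is "_ \<subseteq> ?R")
  proof
    fix \<phi> assume \<phi>: "\<phi> \<in> ?F xs"
    show "\<phi> \<in> ?R"
    proof (cases \<phi>)
      case (Var k)
      then show ?thesis using \<phi> by auto
    next
      case (Imp \<alpha> \<beta>)
      then have "length (leaves \<alpha>) \<in> {1..<length xs}"
          "leaves \<alpha> = take (length (leaves \<alpha>)) xs" "leaves \<beta> = drop (length (leaves \<alpha>)) xs"
        using \<phi> by (auto simp: Suc_le_eq)
      then show ?thesis unfolding Imp by blast
    qed
  qed
  moreover have "finite ?R"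
    using 1 by (intro finite_UnI finite_UN_I finite_imageI finite_cartesian_product) auto
  ultimately show ?case by (rule finite_subset)
qed

lemma finite_bracketings: "finite (bracketings n)"
  unfolding bracketings_def by (rule finite_leaves_eq)

lemma finite_valuations: "finite (valuations m v n)"
  unfolding valuations_def chain_def by (intro finite_PiE) auto

lemma set_leaves_bracketings: "\<phi> \<in> bracketings n \<Longrightarrow> set (leaves \<phi>) = {1..n}"
  by (auto simp: bracketings_def)

lemma bracketings_0 [simp]: "bracketings 0 = {}"
  by (simp add: bracketings_def)

section \<open>Gluing and cutting of valuations and bracketings\<close>

definition join :: "nat \<Rightarrow> (nat \<Rightarrow> 'a) \<Rightarrow> (nat \<Rightarrow> 'a) \<Rightarrow> nat \<Rightarrow> 'a" where
  "join k \<mu> \<rho> x = (if x \<le> k then \<mu> x else \<rho> (x - k))"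

lemma join_valuation:
  assumes "\<mu> \<in> valuations m v k" "\<rho> \<in> valuations m v l"
  shows "join k \<mu> \<rho> \<in> valuations m v (k + l)"
proof -
  have "join k \<mu> \<rho> x \<in> chain m v" if "x \<in> {1..k + l}" for x
  proof (cases "x \<le> k")
    case True
    then show ?thesis
      using assms(1) that by (auto simp: valuations_def join_def PiE_iff)
  next
    case False
    then have "x - k \<in> {1..l}" using that by auto
    then show ?thesis
      using assms(2) False by (auto simp: valuations_def join_def PiE_iff)
  qed
  moreover have "join k \<mu> \<rho> x = undefined" if "x \<notin> {1..k + l}" for x
  proof (cases "x \<le> k")
    \<comment> \<open>Here \<open>x = 0\<close>, the only index up to \<open>k\<close> outside
      \<open>{1..k + l}\<close>. The left branch of \<open>join\<close> covers it, and
      \<open>\<mu>\<close> is \<open>undefined\<close> there by extensionality.\<close>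
    case True
    then have "x \<notin> {1..k}" using that by auto
    then show ?thesis
      using assms(1) True by (auto simp: valuations_def join_def PiE_iff extensional_def)
  next
    case False
    then have "x - k \<notin> {1..l}" using that by auto
    then show ?thesis
      using assms(2) False by (simp add: valuations_def join_def PiE_iff extensional_def)
  qed
  ultimately show ?thesis
    unfolding valuations_def by (intro PiE_I)
qed

text \<open>Together with \<open>restrict_join_right\<close> this makes \<open>join\<close>
  injective on valuations. Restricting loses nothing, since members of \<open>valuations\<close> are
  \<open>undefined\<close> outside their index range.\<close>

lemma restrict_join_left:
  "\<mu> \<in> valuations m v k \<Longrightarrow> restrict (join k \<mu> \<rho>) {1..k} = \<mu>"
  unfolding valuations_def by (auto simp: join_def PiE_iff extensional_def fun_eq_iff)

lemma restrict_join_right: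
  "\<rho> \<in> valuations m v l \<Longrightarrow> restrict (\<lambda>x. join k \<mu> \<rho> (x + k)) {1..l} = \<rho>"
  unfolding valuations_def by (auto simp: join_def PiE_iff extensional_def fun_eq_iff)

lemma join_restrict:
  assumes "\<nu> \<in> valuations m v (k + l)"
  shows "join k (restrict \<nu> {1..k}) (restrict (\<lambda>x. \<nu> (x + k)) {1..l}) = \<nu>"
proof
  fix x
  show "join k (restrict \<nu> {1..k}) (restrict (\<lambda>x. \<nu> (x + k)) {1..l}) x = \<nu> x"
    using assms unfolding valuations_def
    \<comment> \<open>The index \<open>0\<close> lies below both ranges, so both sides are
      \<open>undefined\<close> there.\<close>
    by (cases "x = 0") (auto simp: join_def PiE_iff extensional_def)
qed

lemma Imp_rename_bracketing:
  assumes "\<phi> \<in> bracketings k" "\<psi> \<in> bracketings l"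
  shows "Imp \<phi> (rename (\<lambda>x. x + k) \<psi>) \<in> bracketings (k + l)"
proof -
  have "map (\<lambda>x. x + k) [1..<Suc l] = [Suc k..<Suc (k + l)]"
    by (rule nth_equalityI) (auto simp del: upt_Suc)
  then show ?thesis
    using assms upt_add_eq_append[of 1 "Suc k" l]
    by (simp add: bracketings_def del: upt_Suc)
qed

text \<open>The leaf count of the left factor fixes where the list of variables is cut, so the
  leaves of \<open>\<psi>\<close> are exactly \<open>k + 1\<close> up to \<open>k + l\<close>. All
  of them exceed \<open>k\<close>, which is why the truncated subtraction can be undone.\<close>

lemma bracketings_Imp:
  assumes "Imp \<phi> \<psi> \<in> bracketings (k + l)" "length (leaves \<phi>) = k"
  shows "\<phi> \<in> bracketings k" "rename (\<lambda>x. x - k) \<psi> \<in> bracketings l"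
    "rename (\<lambda>x. x + k) (rename (\<lambda>x. x - k) \<psi>) = \<psi>"
proof -
  have "leaves \<phi> @ leaves \<psi> = [1..<Suc k] @ [Suc k..<Suc (k + l)]"
    using assms(1) upt_add_eq_append[of 1 "Suc k" l] by (simp add: bracketings_def del: upt_Suc)
  then have *: "leaves \<phi> = [1..<Suc k]" "leaves \<psi> = [Suc k..<Suc (k + l)]"
    using assms(2) by (simp_all add: append_eq_append_conv del: upt_Suc)
  then show "\<phi> \<in> bracketings k" by (simp add: bracketings_def)
  have "map (\<lambda>x. x - k) [Suc k..<Suc (k + l)] = [1..<Suc l]"
    by (rule nth_equalityI) (auto simp del: upt_Suc)
  then show "rename (\<lambda>x. x - k) \<psi> \<in> bracketings l"
    using * by (simp add: bracketings_def del: upt_Suc)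
  show "rename (\<lambda>x. x + k) (rename (\<lambda>x. x - k) \<psi>) = \<psi>"
    unfolding rename_rename using * by (intro rename_id_on) (auto simp del: upt_Suc)
qed

section \<open>Counting valued bracketings with a left factor of given size\<close>

definition valued_bracketings :: "nat \<Rightarrow> (nat \<Rightarrow> 'a) \<Rightarrow> nat \<Rightarrow> nat \<Rightarrow> (formula \<times> (nat \<Rightarrow> 'a)) set" where
  "valued_bracketings m v i n =
     {(\<phi>, \<nu>). \<phi> \<in> bracketings n \<and> \<nu> \<in> valuations m v n \<and> val m v \<nu> \<phi> = v i}"

text \<open>Fixing the number \<open>k\<close> of leaves of the left factor slices the set counted
  by \<open>N\<close> into the summands of the convolution.\<close>

definition split_bracketings ::
  "nat \<Rightarrow> (nat \<Rightarrow> 'a) \<Rightarrow> nat \<Rightarrow> nat \<Rightarrow> nat \<Rightarrow> nat \<Rightarrow> (formula \<times> (nat \<Rightarrow> 'a)) set" where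
  "split_bracketings m v i j n k =
     {(\<chi>, \<nu>). \<chi> \<in> bracketings n \<and> \<nu> \<in> valuations m v n \<and>
        (\<exists>\<phi> \<psi>. \<chi> = Imp \<phi> \<psi> \<and> length (leaves \<phi>) = k \<and>
           val m v \<nu> \<phi> = v i \<and> val m v \<nu> \<psi> = v j)}"

lemma val_join_left:
  assumes "\<phi> \<in> bracketings k"
  shows "val m v (join k \<mu> \<rho>) \<phi> = val m v \<mu> \<phi>"
  using assms by (intro val_cong) (auto simp: set_leaves_bracketings join_def)

lemma val_join_right:
  assumes "\<psi> \<in> bracketings l"
  shows "val m v (join k \<mu> \<rho>) (rename (\<lambda>x. x + k) \<psi>) = val m v \<rho> \<psi>"
  unfolding val_rename
  using assms by (intro val_cong) (auto simp: set_leaves_bracketings join_def)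

lemma card_split_bracketings:
  "card (split_bracketings m v i j (k + l) k) = g m v i k * g m v j l"
proof -
  let ?A = "valued_bracketings m v i k" and ?B = "valued_bracketings m v j l"
  let ?S = "split_bracketings m v i j (k + l) k"
  define f where
    "f = (\<lambda>((\<phi>, \<mu>), (\<psi>, \<rho>)). (Imp \<phi> (rename (\<lambda>x. x + k) \<psi>), join k \<mu> \<rho> :: nat \<Rightarrow> 'a))"
  have "inj_on f (?A \<times> ?B)"
  proof (rule inj_onI)
    fix y z assume yz: "y \<in> ?A \<times> ?B" "z \<in> ?A \<times> ?B" and eq: "f y = f z"
    obtain \<phi> \<mu> \<psi> \<rho> where y: "y = ((\<phi>, \<mu>), (\<psi>, \<rho>))" by (metis surj_pair)
    obtain \<phi>' \<mu>' \<psi>' \<rho>' where z: "z = ((\<phi>', \<mu>'), (\<psi>', \<rho>'))" by (metis surj_pair)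
    have eqs: "\<phi> = \<phi>'" "rename (\<lambda>x. x + k) \<psi> = rename (\<lambda>x. x + k) \<psi>'"
        "join k \<mu> \<rho> = join k \<mu>' \<rho>'"
      using eq unfolding f_def y z by simp_all
    \<comment> \<open>Shifting up and then down is the identity on every natural number, so no
      condition on the leaves of \<open>\<chi>\<close> arises in this direction.\<close>
    have "rename (\<lambda>x. x - k) (rename (\<lambda>x. x + k) \<chi>) = \<chi>" for \<chi>
      unfolding rename_rename by (intro rename_id_on) auto
    then have "\<psi> = \<psi>'"
      using eqs(2) by metis
    have vals: "\<mu> \<in> valuations m v k" "\<mu>' \<in> valuations m v k"
        "\<rho> \<in> valuations m v l" "\<rho>' \<in> valuations m v l"
      using yz by (simp_all add: y z valued_bracketings_def)
    have "\<mu> = \<mu>'"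
      using restrict_join_left[OF vals(1), of \<rho>] restrict_join_left[OF vals(2), of \<rho>']
      unfolding eqs(3) by (rule trans[OF sym])
    moreover have "\<rho> = \<rho>'"
      using restrict_join_right[OF vals(3), of k \<mu>] restrict_join_right[OF vals(4), of k \<mu>']
      unfolding eqs(3) by (rule trans[OF sym])
    ultimately show "y = z"
      using eqs(1) \<open>\<psi> = \<psi>'\<close> by (simp add: y z)
  qed
  moreover have "f ` (?A \<times> ?B) = ?S"
  proof (intro equalityI subsetI)
    fix z assume "z \<in> f ` (?A \<times> ?B)"
    then obtain \<phi> \<mu> \<psi> \<rho> where *: "(\<phi>, \<mu>) \<in> ?A" "(\<psi>, \<rho>) \<in> ?B"
      and z: "z = (Imp \<phi> (rename (\<lambda>x. x + k) \<psi>), join k \<mu> \<rho>)"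
      unfolding f_def by auto
    have "length (leaves \<phi>) = k"
      using *(1) by (auto simp: valued_bracketings_def bracketings_def)
    then show "z \<in> ?S"
      using * unfolding z valued_bracketings_def split_bracketings_def
      by (auto simp: Imp_rename_bracketing join_valuation val_join_left val_join_right)
  next
    fix z assume "z \<in> ?S"
    then obtain \<phi> \<psi> \<nu> where z: "z = (Imp \<phi> \<psi>, \<nu>)" and br: "Imp \<phi> \<psi> \<in> bracketings (k + l)"
      and \<nu>: "\<nu> \<in> valuations m v (k + l)" and len: "length (leaves \<phi>) = k"
      and vals: "val m v \<nu> \<phi> = v i" "val m v \<nu> \<psi> = v j"
      unfolding split_bracketings_def by blast
    \<comment> \<open>The preimage under \<open>f\<close>: the right factor is shifted down by
      \<open>k\<close>, and the valuation is cut after position \<open>k\<close>.\<close>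
    define \<psi>' \<mu> \<rho> where "\<psi>' = rename (\<lambda>x. x - k) \<psi>" and "\<mu> = restrict \<nu> {1..k}"
      and "\<rho> = restrict (\<lambda>x. \<nu> (x + k)) {1..l}"
    note bi = bracketings_Imp[OF br len, folded \<psi>'_def]
    have join: "join k \<mu> \<rho> = \<nu>"
      unfolding \<mu>_def \<rho>_def by (rule join_restrict[OF \<nu>])
    have "\<mu> \<in> valuations m v k" "\<rho> \<in> valuations m v l"
      using \<nu> unfolding \<mu>_def \<rho>_def valuations_def by (auto simp: PiE_iff)
    moreover have "val m v \<mu> \<phi> = v i" "val m v \<rho> \<psi>' = v j"
      using vals val_join_left[OF bi(1), of m v \<mu> \<rho>] val_join_right[OF bi(2), of m v k \<mu> \<rho>]
      by (simp_all add: join bi(3))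
    ultimately have "((\<phi>, \<mu>), (\<psi>', \<rho>)) \<in> ?A \<times> ?B"
      using bi by (simp add: valued_bracketings_def)
    moreover have "f ((\<phi>, \<mu>), (\<psi>', \<rho>)) = z"
      by (simp add: f_def z join bi(3))
    ultimately show "z \<in> f ` (?A \<times> ?B)" by (metis imageI)
  qed
  ultimately have "card ?S = card (?A \<times> ?B)"
    by (metis card_image)
  then show ?thesis
    by (simp add: card_cartesian_product valued_bracketings_def g_def)
qed

section \<open>The convolution formula and the generating functions\<close>

lemma length_leaves_bracketings: "\<phi> \<in> bracketings n \<Longrightarrow> length (leaves \<phi>) = n"
  by (simp add: bracketings_def)

text \<open>Every compound bracketing lies in exactly one slice, determined by its left leaf count.
  The end terms \<open>k = 0\<close> and \<open>k = n\<close> may be included: they vanish because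
  \<open>bracketings 0\<close> is empty.\<close>

lemma N_eq_convolution: "N m v i j n = (\<Sum>k=0..n. g m v i k * g m v j (n - k))"
proof -
  let ?S = "split_bracketings m v i j n"
  have "N m v i j n = card (\<Union>k\<in>{0..n}. ?S k)"
  proof (cases "n \<ge> 2")
    case True
    then have "N m v i j n = card {(\<chi>, \<nu>). \<chi> \<in> bracketings n \<and> \<nu> \<in> valuations m v n \<and>
        (\<exists>\<phi> \<psi>. \<chi> = Imp \<phi> \<psi> \<and> val m v \<nu> \<phi> = v i \<and> val m v \<nu> \<psi> = v j)}"
      by (simp add: N_def)
    also have "\<dots> = card (\<Union>k\<in>{0..n}. ?S k)"
      by (rule arg_cong[where f = card])
        (force simp: split_bracketings_def dest: length_leaves_bracketings)
    finally show ?thesis .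
  next
    case False
    \<comment> \<open>A compound formula has at least two leaves. So for \<open>n < 2\<close> all
      slices are empty, matching the value \<open>0\<close> prescribed in \<open>N\<close>.\<close>
    have "Imp \<phi> \<psi> \<notin> bracketings n" for \<phi> \<psi>
    proof
      assume "Imp \<phi> \<psi> \<in> bracketings n"
      then have "length (leaves \<phi>) + length (leaves \<psi>) = n"
        using length_leaves_bracketings by fastforce
      moreover have "length (leaves \<phi>) > 0" "length (leaves \<psi>) > 0" by simp_all
      ultimately show False using False by linarith
    qed
    then have "(\<Union>k\<in>{0..n}. ?S k) = {}" by (auto simp: split_bracketings_def)
    then show ?thesis using False unfolding N_def by simp
  qed
  also have "\<dots> = (\<Sum>k\<in>{0..n}. card (?S k))"
  proof (rule card_UN_disjoint)
    have "?S k \<subseteq> bracketings n \<times> valuations m v n" for k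
      by (auto simp: split_bracketings_def)
    then show "\<forall>k\<in>{0..n}. finite (?S k)"
      using finite_subset[OF _ finite_cartesian_product[OF finite_bracketings finite_valuations]]
      by metis
    show "\<forall>k\<in>{0..n}. \<forall>l\<in>{0..n}. k \<noteq> l \<longrightarrow> ?S k \<inter> ?S l = {}"
      by (auto simp: split_bracketings_def)
  qed simp
  also have "\<dots> = (\<Sum>k=0..n. g m v i k * g m v j (n - k))"
  proof (rule sum.cong)
    fix k assume "k \<in> {0..n}"
    then show "card (?S k) = g m v i k * g m v j (n - k)"
      using card_split_bracketings[of m v i j k "n - k"] by simp
  qed simp
  finally show ?thesis .
qed

lemma N_series_eq_mult: "N_series m v i j = G m v i * G m v j"
proof -
  have "G m v k = Abs_fps (g m v k)" for k
    by (simp add: G_def g_def fps_eq_iff Suc_le_eq)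
  moreover have "N_series m v i j = Abs_fps (N m v i j)"
    by (simp add: N_series_def N_def fps_eq_iff)
  ultimately show ?thesis
    by (simp add: fps_eq_iff fps_mult_nth N_eq_convolution)
qed

section \<open>Output values and the number of contributing pairs\<close>

lemma goedel_imp_chain:
  assumes "inj_on v {..<m}" "i < m" "j < m"
  shows "goedel_imp m v (v i) (v j) = (if i \<le> j then v (m - 1) else v j)"
  using assms by (simp add: goedel_imp_def chain_index_def inv_into_f_f Let_def)

text \<open>The tag alone makes the map injective, whatever \<open>F\<close> is. Hence counting
  tagged sequences amounts to counting index pairs.\<close>

lemma card_tagged_image: "card ((\<lambda>(i, j). ((i, j), F i j)) ` S) = card S"
  by (rule card_image) (auto simp: inj_on_def)

lemma card_le_pairs: "card {(i, j). i \<le> j \<and> j < (m::nat)} = m * (m + 1) div 2"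
proof -
  \<comment> \<open>Grouping the pairs by the larger index \<open>j\<close> leaves
    \<open>j + 1\<close> choices for \<open>i\<close>, which gives a triangular number.\<close>
  have "{(i, j). i \<le> j \<and> j < m} = prod.swap ` (SIGMA j:{..<m}. {..j})"
    by (auto simp: image_iff)
  then have "card {(i, j). i \<le> j \<and> j < m} = card (SIGMA j:{..<m}. {..j})"
    by (simp add: card_image)
  also have "\<dots> = (\<Sum>j<m. Suc j)" by simp
  also have "\<dots> = m * (m + 1) div 2" by (induction m) auto
  finally show ?thesis .
qed

theorem theorem9:
  fixes m :: nat and v :: "nat \<Rightarrow> 'a :: {linorder, zero, one}"
  assumes "m \<ge> 2"
    and "strict_mono_on {..<m} v"
    and "v 0 = 0" and "v (m - 1) = 1"
  shows
    "(card (pair_sequences m v) = m\<^sup>2 \<and>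
      bij_betw fst (pair_sequences m v) ({..<m} \<times> {..<m})) \<and>
     (\<forall>i<m. \<forall>j<m. N_series m v i j = G m v i * G m v j \<and> N m v i j 1 = 0) \<and>
     (\<forall>i<m. \<forall>j<m.
        (i \<le> j \<longrightarrow> goedel_imp m v (v i) (v j) = v (m - 1) \<and> v (m - 1) = 1) \<and>
        (i > j \<longrightarrow> goedel_imp m v (v i) (v j) = v j)) \<and>
     (contributing m v (m - 1) = {((i, j), s) \<in> pair_sequences m v. i \<le> j} \<and>
      card (contributing m v (m - 1)) = m * (m + 1) div 2) \<and>
     (\<forall>j\<le>m - 2.
        contributing m v j = {((i, j'), s) \<in> pair_sequences m v. j' = j \<and> i > j} \<and>
        card (contributing m v j) = m - 1 - j)"
proof -
  have inj: "inj_on v {..<m}"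
    using assms(2) by (rule strict_mono_on_imp_inj_on)
  note imp = goedel_imp_chain[OF inj]
  have v_eq: "v a = v b \<longleftrightarrow> a = b" if "a < m" "b < m" for a b
    using inj that by (auto dest: inj_onD)
  have "card (pair_sequences m v) = m\<^sup>2"
    unfolding pair_sequences_def by (simp add: card_tagged_image power2_eq_square)
  moreover have "bij_betw fst (pair_sequences m v) ({..<m} \<times> {..<m})"
    unfolding pair_sequences_def by (force simp: bij_betw_def inj_on_def)
  moreover have top: "contributing m v (m - 1) = {((i, j), s) \<in> pair_sequences m v. i \<le> j}"
    using \<open>m \<ge> 2\<close> unfolding contributing_def pair_sequences_def
    by (auto simp: imp v_eq split: if_splits)
  moreover have "card (contributing m v (m - 1)) = m * (m + 1) div 2"
  proof -
    have "contributing m v (m - 1) =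
        (\<lambda>(i, j). ((i, j), N m v i j)) ` {(i, j). i \<le> j \<and> j < m}"
      unfolding top pair_sequences_def by force
    then show ?thesis by (simp add: card_tagged_image card_le_pairs)
  qed
  moreover have "contributing m v j = {((i, j'), s) \<in> pair_sequences m v. j' = j \<and> i > j}"
      (is "_ = ?C") and "card (contributing m v j) = m - 1 - j" if "j \<le> m - 2" for j
  proof -
    \<comment> \<open>Since \<open>j\<close> is not the top index, \<open>v j\<close> differs from
      \<open>v (m - 1)\<close>. So no pair with ordered indices yields \<open>v j\<close>, and a
      contributing pair must have right index \<open>j\<close> and a larger left index.\<close>
    have "j < m" "j \<noteq> m - 1" using that \<open>m \<ge> 2\<close> by auto
    then show C: "contributing m v j = ?C"
      using \<open>m \<ge> 2\<close> unfolding contributing_def pair_sequences_def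
      by (auto simp: imp v_eq split: if_splits)
    have "?C = (\<lambda>(i, j). ((i, j), N m v i j)) ` ({j<..<m} \<times> {j})"
      unfolding pair_sequences_def using \<open>j < m\<close> by force
    then show "card (contributing m v j) = m - 1 - j"
      by (simp add: C card_tagged_image card_cartesian_product)
  qed
  ultimately show ?thesis
    using assms(4) by (simp add: N_series_eq_mult imp) (simp add: N_def)
qed

end
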